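(* The Reissner-Nordström-de Sitter spacetime $(U,g)$ with parameters $M,e,\Lambda$ (metric and conventions as in the context) is a Roter type manifold: there are scalar functions $N_1,N_2,N_3$ on $U$ such that $$R=N_1\,(Ric\wedge Ric)+N_2\,(g\wedge Ric)+N_3\,(g\wedge g).$$
   Context: Metric: $M>0$ (mass), $e\neq 0$ (electric charge), $\Lambda>0$ (cosmological constant) are real constants, $f(r)=1-\frac{2M}{r}+\frac{e^2}{r^2}-\Lambda r^2$, and on the coordinate domain $U=\{(t,r,\theta,\phi): r>0,\ f(r)\ne 0,\ 0<\theta<\pi\}$ with coordinates $(t,r,\theta,\phi)$ the Reissner-Nordström-de Sitter (RNdS) metric is $g=-f\,dt^2+f^{-1}dr^2+r^2(d\theta^2+\sin^2\theta\,d\phi^2)$. $R$ is the $(0,4)$ Riemann curvature tensor and $Ric$ the Ricci tensor of $g$ (overall sign conventions are irrelevant here). For symmetric $(0,2)$ tensors $F,H$, the Kulkarni-Nomizu product is $(F\wedge H)_{ijkl}=F_{il}H_{jk}-F_{ik}H_{jl}+F_{jk}H_{il}-F_{jl}H_{ik}$. *)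

theory Defs
  imports "HOL-Analysis.Analysis"
begin

section \<open>Curvature of a metric in a coordinate chart\<close>

text \<open>
  Tensors are given by their components in a fixed coordinate chart of \<^typ>\<open>real ^ 'n\<close>,
  with coordinate indices in \<^typ>\<open>'n\<close>.
\<close>

type_synonym 'n tensor2 = "real ^ 'n ^ 'n"
type_synonym 'n tensor4 = "'n \<Rightarrow> 'n \<Rightarrow> 'n \<Rightarrow> 'n \<Rightarrow> real"

definition partial_deriv :: "'n::finite \<Rightarrow> (real ^ 'n \<Rightarrow> real) \<Rightarrow> real ^ 'n \<Rightarrow> real" where
  "partial_deriv k h x = deriv (\<lambda>s. h (x + s *\<^sub>R axis k 1)) 0"

text \<open>Upper index first: \<^term>\<open>christoffel g m i j\<close> is $\Gamma^m_{ij}$.\<close>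

definition christoffel ::
    "(real ^ 'n \<Rightarrow> 'n::finite tensor2) \<Rightarrow> 'n \<Rightarrow> 'n \<Rightarrow> 'n \<Rightarrow> real ^ 'n \<Rightarrow> real" where
  "christoffel g m i j x =
     (1 / 2) * (\<Sum>l\<in>UNIV. matrix_inv (g x) $ m $ l *
       (partial_deriv i (\<lambda>y. g y $ j $ l) x
        + partial_deriv j (\<lambda>y. g y $ i $ l) x
        - partial_deriv l (\<lambda>y. g y $ i $ j) x))"

text \<open>
  \<^term>\<open>riemann_up g m i j k\<close> is the coefficient of $\partial_m$ in
  $R(\partial_i,\partial_j)\partial_k
    = \nabla_i\nabla_j\partial_k - \nabla_j\nabla_i\partial_k$.
\<close>

definition riemann_up ::
    "(real ^ 'n \<Rightarrow> 'n::finite tensor2) \<Rightarrow> 'n \<Rightarrow> 'n \<Rightarrow> 'n \<Rightarrow> 'n \<Rightarrow> real ^ 'n \<Rightarrow> real" where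
  "riemann_up g m i j k x =
     partial_deriv i (christoffel g m j k) x
     - partial_deriv j (christoffel g m i k) x
     + (\<Sum>p\<in>UNIV. christoffel g m i p x * christoffel g p j k x)
     - (\<Sum>p\<in>UNIV. christoffel g m j p x * christoffel g p i k x)"

text \<open>
  $R_{ijkl} = g(R(\partial_i,\partial_j)\partial_k,\partial_l)$; with this convention a metric
  of constant curvature $\kappa$ has
  $R_{ijkl} = \kappa\,(g_{il}g_{jk} - g_{ik}g_{jl})$, and the Ricci tensor below, the trace of
  $X \mapsto R(X,\partial_j)\partial_k$, is positive on round spheres.
\<close>

definition riemann :: "(real ^ 'n \<Rightarrow> 'n::finite tensor2) \<Rightarrow> real ^ 'n \<Rightarrow> 'n tensor4" where
  "riemann g x i j k l = (\<Sum>m\<in>UNIV. riemann_up g m i j k x * g x $ m $ l)"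

definition ricci :: "(real ^ 'n \<Rightarrow> 'n::finite tensor2) \<Rightarrow> real ^ 'n \<Rightarrow> 'n tensor2" where
  "ricci g x = (\<chi> j k. \<Sum>m\<in>UNIV. riemann_up g m m j k x)"

definition kulkarni_nomizu :: "'n::finite tensor2 \<Rightarrow> 'n tensor2 \<Rightarrow> 'n tensor4" where
  "kulkarni_nomizu F H i j k l =
     F $ i $ l * H $ j $ k - F $ i $ k * H $ j $ l
     + F $ j $ k * H $ i $ l - F $ j $ l * H $ i $ k"

definition roter_type_on :: "(real ^ 'n) set \<Rightarrow> (real ^ 'n \<Rightarrow> 'n::finite tensor2) \<Rightarrow> bool" where
  "roter_type_on U g \<longleftrightarrow>
     (\<exists>N1 N2 N3 :: real ^ 'n \<Rightarrow> real. \<forall>x\<in>U. \<forall>i j k l.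
        riemann g x i j k l =
          N1 x * kulkarni_nomizu (ricci g x) (ricci g x) i j k l
          + N2 x * kulkarni_nomizu (g x) (ricci g x) i j k l
          + N3 x * kulkarni_nomizu (g x) (g x) i j k l)"

section \<open>Reissner--Nordstroem--de Sitter spacetime\<close>

text \<open>
  A point is \<^term>\<open>x :: real ^ 4\<close> with components
  $(x_1, x_2, x_3, x_4) = (t, r, \theta, \phi)$.
\<close>

definition rnds_f :: "real \<Rightarrow> real \<Rightarrow> real \<Rightarrow> real \<Rightarrow> real" where
  "rnds_f M e \<Lambda> r = 1 - 2 * M / r + e\<^sup>2 / r\<^sup>2 - \<Lambda> * r\<^sup>2"

definition rnds_domain :: "real \<Rightarrow> real \<Rightarrow> real \<Rightarrow> (real ^ 4) set" where
  "rnds_domain M e \<Lambda> =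
     {x. x $ 2 > 0 \<and> rnds_f M e \<Lambda> (x $ 2) \<noteq> 0 \<and> 0 < x $ 3 \<and> x $ 3 < pi}"

definition rnds_metric :: "real \<Rightarrow> real \<Rightarrow> real \<Rightarrow> real ^ 4 \<Rightarrow> 4 tensor2" where
  "rnds_metric M e \<Lambda> x =
     (\<chi> i j. if i \<noteq> j then 0
            else if i = 1 then - rnds_f M e \<Lambda> (x $ 2)
            else if i = 2 then 1 / rnds_f M e \<Lambda> (x $ 2)
            else if i = 3 then (x $ 2)\<^sup>2
            else (x $ 2)\<^sup>2 * (sin (x $ 3))\<^sup>2)"

end

theory Submission
  imports Defs
begin

text \<open>
  In the coordinates $(t,r,\theta,\phi)$ the metric is diagonal, static and spherically symmetric,
  and its curvature operator is diagonal on the coordinate bivectors: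
  $R_{ijkl} = K_{ij}(g_{il}g_{jk} - g_{ik}g_{jl})$, where
  $K_{tr} = -f''/2$, $K_{\theta\phi} = (1-f)/r^2$ and the four mixed planes share the value
  $-f'/(2r)$ (\<open>riemann_static_metric\<close>). The Ricci tensor therefore has one eigenvalue $a$ on
  $(t,r)$ and one eigenvalue $b$ on $(\theta,\phi)$ (\<open>ricci_static_metric\<close>). The
  Kulkarni--Nomizu products are diagonal on bivectors too, so the Roter equation reduces to
  three scalar equations, one for each curvature value:
  $K_{ij} = 2N_1\rho_i\rho_j + N_2(\rho_i+\rho_j) + 2N_3$ with $\rho_i,\rho_j \in \{a,b\}$.
  These are solvable whenever $a \neq b$ (\<open>roter_coefficients_exist\<close>).

  Since $a - b = K_{tr} - K_{\theta\phi}$, the criterion \<open>roter_type_static_metric\<close> holds for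
  every profile $f$ with $-f''/2 \neq (1-f)/r^2$. For the Reissner--Nordstroem--de Sitter profile
  the difference is $-2e^2/r^4$, which does not vanish because the charge is nonzero.

  The curvature is computed through Christoffel symbols, each of which is a function of
  $r$ times a function of $\theta$ (\<open>christoffel_static_metric\<close>).
\<close>

section \<open>Diagonal metrics\<close>

lemma matrix_inv_eq:
  fixes A B :: "real ^ 'n ^ 'n"
  assumes "A ** B = mat 1" and "B ** A = mat 1"
  shows "matrix_inv A = B"
proof -
  have "A ** matrix_inv A = mat 1 \<and> matrix_inv A ** A = mat 1"
    unfolding matrix_inv_def using assms by (intro someI) blast
  then have "matrix_inv A ** (A ** B) = B"
    by (simp add: matrix_mul_assoc)
  then show ?thesis
    using assms(1) by simp
qed

definition diagonal_metric :: "('n \<Rightarrow> real ^ 'n \<Rightarrow> real) \<Rightarrow> real ^ 'n \<Rightarrow> 'n::finite tensor2" where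
  "diagonal_metric h x = (\<chi> i j. if i = j then h i x else 0)"

lemma diagonal_metric_nth [simp]:
  "diagonal_metric h x $ i $ j = (if i = j then h i x else 0)"
  by (simp add: diagonal_metric_def)

lemma matrix_inv_diagonal_metric:
  assumes "\<And>i. h i x \<noteq> 0"
  shows "matrix_inv (diagonal_metric h x) = (\<chi> i j. if i = j then 1 / h i x else 0)"
  by (rule matrix_inv_eq)
    (simp_all add: vec_eq_iff matrix_matrix_mult_def mat_def mult_delta_left mult_delta_right assms)

lemma partial_deriv_zero [simp]: "partial_deriv k (\<lambda>x. 0) x = 0"
  by (simp add: partial_deriv_def)

lemma partial_deriv_if:
  "partial_deriv k (\<lambda>y. if P then h y else 0) x = (if P then partial_deriv k h x else 0)"
  by simp

lemma christoffel_diagonal_metric: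
  assumes "\<And>i. h i x \<noteq> 0"
  shows "christoffel (diagonal_metric h) m i j x =
     ((if j = m then partial_deriv i (h m) x else 0)
      + (if i = m then partial_deriv j (h m) x else 0)
      - (if i = j then partial_deriv m (h i) x else 0)) / (2 * h m x)"
proof -
  have "christoffel (diagonal_metric h) m i j x =
     (1 / 2) * (\<Sum>l\<in>UNIV. if l = m then (partial_deriv i (\<lambda>y. diagonal_metric h y $ j $ l) x
        + partial_deriv j (\<lambda>y. diagonal_metric h y $ i $ l) x
        - partial_deriv l (\<lambda>y. diagonal_metric h y $ i $ j) x) / h m x else 0)"
    unfolding christoffel_def matrix_inv_diagonal_metric[of h x, OF assms]
    by (intro arg_cong2[where f = "(*)"] sum.cong) auto
  then show ?thesis
    by (auto simp: partial_deriv_if)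
qed

section \<open>Partial derivatives in the radial and polar coordinates\<close>

text \<open>
  Closed formulas for Christoffel symbols hold only where the metric is nondegenerate; this is what
  allows such a formula to be differentiated at an interior point of that set.
\<close>

lemma partial_deriv_cong:
  assumes "\<forall>\<^sub>F y in nhds x. h y = k y"
  shows "partial_deriv i h x = partial_deriv i k x"
proof -
  have "((\<lambda>s. x + s *\<^sub>R axis i 1) \<longlongrightarrow> x + 0 *\<^sub>R axis i 1) (nhds (0::real))"
    by (intro tendsto_intros filterlim_ident)
  then have "\<forall>\<^sub>F s in nhds 0. h (x + s *\<^sub>R axis i 1) = k (x + s *\<^sub>R axis i 1)"
    using eventually_compose_filterlim[OF assms] by simp
  then show ?thesis
    unfolding partial_deriv_def by (intro deriv_cong_ev refl)
qed

lemma partial_deriv_product: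
  fixes x :: "real ^ 4"
  assumes "(a has_real_derivative a') (at (x $ 2))"
    and "(b has_real_derivative b') (at (x $ 3))"
  shows "partial_deriv k (\<lambda>y. a (y $ 2) * b (y $ 3)) x =
    (if k = 2 then a' * b (x $ 3) else if k = 3 then a (x $ 2) * b' else 0)"
proof -
  have shift: "((\<lambda>s. F ((x + s *\<^sub>R axis k 1) $ i))
      has_real_derivative (if k = i then F' else 0)) (at 0)"
    if "(F has_real_derivative F') (at (x $ i))" for F F' and i :: 4
  proof (cases "k = i")
    case True
    have "((\<lambda>s. F (x $ i + s)) has_real_derivative F') (at 0)"
      using that by (simp add: DERIV_shift[symmetric] add.commute)
    then show ?thesis
      using True by (simp add: axis_def)
  qed (simp add: axis_def)
  show ?thesis
    unfolding partial_deriv_def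
    using DERIV_imp_deriv[OF DERIV_mult[OF shift[OF assms(1)] shift[OF assms(2)]]]
    by (simp add: axis_def)
qed

section \<open>Christoffel symbols of a static spherically symmetric metric\<close>

text \<open>
  The diagonal entries of $-f\,dt^2 + f^{-1}dr^2 + r^2(d\theta^2+\sin^2\theta\,d\phi^2)$, split
  into a radial and a polar factor so that \<open>partial_deriv_product\<close> applies.
\<close>

definition static_coeff :: "(real \<Rightarrow> real) \<Rightarrow> 4 \<Rightarrow> real ^ 4 \<Rightarrow> real" where
  "static_coeff f i x =
     (if i = 1 then - f (x $ 2) else if i = 2 then 1 / f (x $ 2) else (x $ 2)\<^sup>2)
     * (if i = 4 then (sin (x $ 3))\<^sup>2 else 1)"

abbreviation static_metric :: "(real \<Rightarrow> real) \<Rightarrow> real ^ 4 \<Rightarrow> 4 tensor2" where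
  "static_metric f \<equiv> diagonal_metric (static_coeff f)"

text \<open>
  The symbol $\Gamma^m_{ij}$ is the radial factor times the polar factor. The arguments \<open>f\<close>,
  \<open>f1\<close>, \<open>f2\<close> are the values of the profile and its first two derivatives at \<open>r\<close>;
  the primed tables hold the derivatives of the factors with respect to \<open>r\<close> and
  \<open>\<theta>\<close>. A vanishing symbol is encoded by a zero radial factor, whence the default value
  \<open>1\<close> of the polar one.
\<close>

definition christoffel_radial :: "real \<Rightarrow> real \<Rightarrow> real \<Rightarrow> 4 \<Rightarrow> 4 \<Rightarrow> 4 \<Rightarrow> real" where
  "christoffel_radial f f1 r m i j =
     (if (m, i, j) \<in> {(1, 1, 2), (1, 2, 1)} then f1 / (2 * f)
      else if (m, i, j) = (2, 1, 1) then f * f1 / 2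
      else if (m, i, j) = (2, 2, 2) then - f1 / (2 * f)
      else if (m, i, j) \<in> {(2, 3, 3), (2, 4, 4)} then - r * f
      else if (m, i, j) \<in> {(3, 2, 3), (3, 3, 2), (4, 2, 4), (4, 4, 2)} then 1 / r
      else if (m, i, j) \<in> {(3, 4, 4), (4, 3, 4), (4, 4, 3)} then 1 else 0)"

definition christoffel_radial' :: "real \<Rightarrow> real \<Rightarrow> real \<Rightarrow> real \<Rightarrow> 4 \<Rightarrow> 4 \<Rightarrow> 4 \<Rightarrow> real" where
  "christoffel_radial' f f1 f2 r m i j =
     (if (m, i, j) \<in> {(1, 1, 2), (1, 2, 1)} then (f2 * f - f1\<^sup>2) / (2 * f\<^sup>2)
      else if (m, i, j) = (2, 1, 1) then (f1\<^sup>2 + f * f2) / 2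
      else if (m, i, j) = (2, 2, 2) then - (f2 * f - f1\<^sup>2) / (2 * f\<^sup>2)
      else if (m, i, j) \<in> {(2, 3, 3), (2, 4, 4)} then - f - r * f1
      else if (m, i, j) \<in> {(3, 2, 3), (3, 3, 2), (4, 2, 4), (4, 4, 2)} then - 1 / r\<^sup>2
      else 0)"

definition christoffel_polar :: "real \<Rightarrow> 4 \<Rightarrow> 4 \<Rightarrow> 4 \<Rightarrow> real" where
  "christoffel_polar \<theta> m i j =
     (if (m, i, j) = (2, 4, 4) then (sin \<theta>)\<^sup>2
      else if (m, i, j) = (3, 4, 4) then - sin \<theta> * cos \<theta>
      else if (m, i, j) \<in> {(4, 3, 4), (4, 4, 3)} then cos \<theta> / sin \<theta>
      else 1)"

definition christoffel_polar' :: "real \<Rightarrow> 4 \<Rightarrow> 4 \<Rightarrow> 4 \<Rightarrow> real" where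
  "christoffel_polar' \<theta> m i j =
     (if (m, i, j) = (2, 4, 4) then 2 * sin \<theta> * cos \<theta>
      else if (m, i, j) = (3, 4, 4) then (sin \<theta>)\<^sup>2 - (cos \<theta>)\<^sup>2
      else if (m, i, j) \<in> {(4, 3, 4), (4, 4, 3)} then - 1 / (sin \<theta>)\<^sup>2
      else 0)"

text \<open>
  The tables are cascades of conditions on the indices, which are constant for differentiation.
\<close>

lemma has_real_derivative_if_const:
  assumes "(h has_real_derivative h') F" and "(k has_real_derivative k') F"
  shows "((\<lambda>s. if P then h s else k s) has_real_derivative (if P then h' else k')) F"
  using assms by simp

lemma DERIV_christoffel_radial:
  assumes "r > 0" and "f r \<noteq> 0"
    and "(f has_real_derivative f1 r) (at r)" and "(f1 has_real_derivative f2) (at r)"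
  shows "((\<lambda>r. christoffel_radial (f r) (f1 r) r m i j)
    has_real_derivative christoffel_radial' (f r) (f1 r) f2 r m i j) (at r)"
proof -
  have "((\<lambda>r. f1 r / (2 * f r)) has_real_derivative (f2 * f r - (f1 r)\<^sup>2) / (2 * (f r)\<^sup>2)) (at r)"
    using assms by (auto intro!: derivative_eq_intros simp: field_simps power2_eq_square)
  moreover from DERIV_minus[OF this]
  have "((\<lambda>r. - f1 r / (2 * f r)) has_real_derivative - (f2 * f r - (f1 r)\<^sup>2) / (2 * (f r)\<^sup>2)) (at r)"
    by (simp only: minus_divide_left)
  moreover have "((\<lambda>r. f r * f1 r / 2) has_real_derivative ((f1 r)\<^sup>2 + f r * f2) / 2) (at r)"
    using assms by (auto intro!: derivative_eq_intros simp: power2_eq_square)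
  moreover have "((\<lambda>r. - r * f r) has_real_derivative - f r - r * f1 r) (at r)"
    using assms by (auto intro!: derivative_eq_intros)
  moreover have "((\<lambda>r. 1 / r) has_real_derivative - 1 / r\<^sup>2) (at r)"
    using assms by (auto intro!: derivative_eq_intros simp: power2_eq_square)
  moreover have "((\<lambda>r. if P then 1 else 0) has_real_derivative 0) (at r)" for P
    by simp
  ultimately show ?thesis
    unfolding christoffel_radial_def christoffel_radial'_def by (intro has_real_derivative_if_const)
qed

lemma DERIV_christoffel_polar:
  assumes "sin \<theta> \<noteq> 0"
  shows "((\<lambda>\<theta>. christoffel_polar \<theta> m i j) has_real_derivative christoffel_polar' \<theta> m i j) (at \<theta>)"
proof -
  have "((\<lambda>\<theta>. cos \<theta> / sin \<theta>) has_real_derivative - 1 / (sin \<theta>)\<^sup>2) (at \<theta>)"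
    using assms DERIV_cot[of \<theta>] by (simp add: cot_def[abs_def] inverse_eq_divide)
  moreover have "((\<lambda>\<theta>. (sin \<theta>)\<^sup>2) has_real_derivative 2 * sin \<theta> * cos \<theta>) (at \<theta>)"
    by (auto intro!: derivative_eq_intros)
  moreover have "((\<lambda>\<theta>. - sin \<theta> * cos \<theta>) has_real_derivative (sin \<theta>)\<^sup>2 - (cos \<theta>)\<^sup>2) (at \<theta>)"
    by (auto intro!: derivative_eq_intros simp: power2_eq_square)
  ultimately show ?thesis
    unfolding christoffel_polar_def christoffel_polar'_def
    by (intro has_real_derivative_if_const DERIV_const)
qed

lemma static_coeff_nonzero:
  assumes "x $ 2 > 0" "f (x $ 2) \<noteq> 0" "sin (x $ 3) \<noteq> 0"
  shows "static_coeff f i x \<noteq> 0"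
  using assms by (simp add: static_coeff_def)

lemma partial_deriv_static_coeff:
  assumes "x $ 2 > 0" "f (x $ 2) \<noteq> 0"
    and "(f has_real_derivative f') (at (x $ 2))"
  shows "partial_deriv k (static_coeff f i) x =
    (if k = 2 then (if i = 1 then - f' else if i = 2 then - f' / (f (x $ 2))\<^sup>2 else 2 * x $ 2)
       * (if i = 4 then (sin (x $ 3))\<^sup>2 else 1)
     else if k = 3 \<and> i = 4 then (x $ 2)\<^sup>2 * (2 * sin (x $ 3) * cos (x $ 3)) else 0)"
proof -
  let ?a = "\<lambda>r. if i = 1 then - f r else if i = 2 then 1 / f r else r\<^sup>2"
  let ?b = "\<lambda>\<theta>. if i = 4 then (sin \<theta>)\<^sup>2 else 1 :: real"
  have a: "(?a has_real_derivative
      (if i = 1 then - f' else if i = 2 then - f' / (f (x $ 2))\<^sup>2 else 2 * x $ 2)) (at (x $ 2))"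
    using assms by (auto intro!: derivative_eq_intros simp: power2_eq_square)
  have b: "(?b has_real_derivative (if i = 4 then 2 * sin (x $ 3) * cos (x $ 3) else 0)) (at (x $ 3))"
    by (auto intro!: derivative_eq_intros)
  have "static_coeff f i = (\<lambda>y. ?a (y $ 2) * ?b (y $ 3))"
    by (simp add: static_coeff_def fun_eq_iff)
  then show ?thesis
    using partial_deriv_product[of ?a _ x ?b, OF a b, of k] by auto
qed

lemma christoffel_static_metric:
  assumes "x $ 2 > 0" "f (x $ 2) \<noteq> 0" "sin (x $ 3) \<noteq> 0"
    and "(f has_real_derivative f1 (x $ 2)) (at (x $ 2))"
  shows "christoffel (static_metric f) m i j x =
    christoffel_radial (f (x $ 2)) (f1 (x $ 2)) (x $ 2) m i j * christoffel_polar (x $ 3) m i j"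
proof -
  have "\<forall>m i j. christoffel (static_metric f) m i j x =
      christoffel_radial (f (x $ 2)) (f1 (x $ 2)) (x $ 2) m i j * christoffel_polar (x $ 3) m i j"
    unfolding christoffel_diagonal_metric[of "static_coeff f" x, OF static_coeff_nonzero[of x f, OF assms(1-3)]]
      partial_deriv_static_coeff[of x f, OF assms(1,2,4)] forall_4
    by (intro conjI; use assms in \<open>simp add: static_coeff_def christoffel_radial_def christoffel_polar_def power2_eq_square\<close>)
  then show ?thesis by blast
qed

lemma partial_deriv_christoffel_static_metric:
  assumes x: "x $ 2 > 0" "f (x $ 2) \<noteq> 0" "sin (x $ 3) \<noteq> 0"
    and f: "\<forall>r>0. (f has_real_derivative f1 r) (at r)"
    and f1: "(f1 has_real_derivative f2) (at (x $ 2))"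
  shows "partial_deriv k (christoffel (static_metric f) m i j) x =
    (if k = 2 then christoffel_radial' (f (x $ 2)) (f1 (x $ 2)) f2 (x $ 2) m i j * christoffel_polar (x $ 3) m i j
     else if k = 3 then christoffel_radial (f (x $ 2)) (f1 (x $ 2)) (x $ 2) m i j * christoffel_polar' (x $ 3) m i j
     else 0)"
proof -
  have c: "((\<lambda>y. y $ i) \<longlongrightarrow> x $ i) (nhds x)" for i
    by (intro tendsto_intros filterlim_ident)
  have fc: "(f \<longlongrightarrow> f (x $ 2)) (nhds (x $ 2))"
    using DERIV_isCont[OF f[rule_format, OF x(1)]] by (simp add: continuous_at tendsto_at_iff_tendsto_nhds)
  have "\<forall>\<^sub>F y in nhds x. y $ 2 > 0"
    using order_tendstoD(1)[OF c x(1)] .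
  moreover have "\<forall>\<^sub>F y in nhds x. f (y $ 2) \<noteq> 0"
    using tendsto_imp_eventually_ne[OF filterlim_compose[OF fc c] x(2)] .
  moreover have "\<forall>\<^sub>F y in nhds x. sin (y $ 3) \<noteq> 0"
    using tendsto_imp_eventually_ne[OF tendsto_sin[OF c] x(3)] .
  ultimately have "\<forall>\<^sub>F y in nhds x. christoffel (static_metric f) m i j y =
      christoffel_radial (f (y $ 2)) (f1 (y $ 2)) (y $ 2) m i j * christoffel_polar (y $ 3) m i j"
    by eventually_elim (simp add: christoffel_static_metric f)
  then show ?thesis
    by (subst partial_deriv_cong, assumption)
      (rule partial_deriv_product DERIV_christoffel_radial DERIV_christoffel_polar x f[rule_format] f1)+
qed

section \<open>Curvature of a static spherically symmetric metric\<close>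

text \<open>
  The sectional curvatures of the coordinate planes: one value for the $(t,r)$ plane, one for
  the $(\theta,\phi)$ plane, and one shared by the four mixed planes. For \<open>i = j\<close> there is
  no plane; the value is then multiplied by zero in the curvature formulas.
\<close>

definition sectional_curvature :: "real \<Rightarrow> real \<Rightarrow> real \<Rightarrow> real \<Rightarrow> 4 \<Rightarrow> 4 \<Rightarrow> real" where
  "sectional_curvature f f1 f2 r i j =
     (if {i, j} \<subseteq> {1, 2} then - f2 / 2
      else if {i, j} \<subseteq> {3, 4} then (1 - f) / r\<^sup>2
      else - f1 / (2 * r))"

lemma distinct_4:
  "(1::4) \<noteq> 2" "(1::4) \<noteq> 3" "(1::4) \<noteq> 4" "(2::4) \<noteq> 1" "(2::4) \<noteq> 3" "(2::4) \<noteq> 4"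
  "(3::4) \<noteq> 1" "(3::4) \<noteq> 2" "(3::4) \<noteq> 4" "(4::4) \<noteq> 1" "(4::4) \<noteq> 2" "(4::4) \<noteq> 3"
  by simp_all

text \<open>
  The reflection of $t$ and the rotations and reflections of the sphere that fix a point are
  isometries; they forbid off-diagonal terms of the curvature operator on coordinate bivectors.
  That the $t$ and $r$ directions have the same mixed curvature comes from $g_{tt}g_{rr} = -1$.
  The term $1$ in $(1-f)/r^2$ is the curvature of the unit sphere and comes from
  $\sin^2\theta + \cos^2\theta = 1$.
\<close>

lemma riemann_up_static_metric:
  assumes x: "x $ 2 > 0" "f (x $ 2) \<noteq> 0" "sin (x $ 3) \<noteq> 0"
    and f: "\<forall>r>0. (f has_real_derivative f1 r) (at r)"
    and f1: "(f1 has_real_derivative f2) (at (x $ 2))"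
  shows "riemann_up (static_metric f) m i j k x =
    sectional_curvature (f (x $ 2)) (f1 (x $ 2)) f2 (x $ 2) i j *
      ((if m = i then static_metric f x $ j $ k else 0)
       - (if m = j then static_metric f x $ i $ k else 0))"
proof -
  have cos2: "cos (x $ 3) * cos (x $ 3) = 1 - sin (x $ 3) * sin (x $ 3)"
    using sin_cos_squared_add[of "x $ 3"] by (simp add: power2_eq_square)
  have "\<forall>m i j k. riemann_up (static_metric f) m i j k x =
    sectional_curvature (f (x $ 2)) (f1 (x $ 2)) f2 (x $ 2) i j *
      ((if m = i then static_metric f x $ j $ k else 0)
       - (if m = j then static_metric f x $ i $ k else 0))"
    unfolding riemann_up_def sum_4 partial_deriv_christoffel_static_metric[of x f f1 f2, OF assms]
      christoffel_static_metric[of x f f1, OF x f[rule_format, OF x(1)]] forall_4 diagonal_metric_nth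
    \<comment> \<open>Deciding all index conditions first leaves only short rational identities in the values
      of the profile, its derivatives, the radius, the sine and the cosine.\<close>
    by (simp_all only: distinct_4 prod.inject insert_iff empty_iff insert_subset empty_subsetI
          simp_thms if_True if_False static_coeff_def sectional_curvature_def
          christoffel_radial_def christoffel_radial'_def
          christoffel_polar_def christoffel_polar'_def)
      (use x in simp_all, intro conjI,
       use x in \<open>simp_all add: field_simps power2_eq_square cos2\<close>)
  then show ?thesis by blast
qed

lemma riemann_static_metric:
  assumes "x $ 2 > 0" "f (x $ 2) \<noteq> 0" "sin (x $ 3) \<noteq> 0"
    and "\<forall>r>0. (f has_real_derivative f1 r) (at r)"
    and "(f1 has_real_derivative f2) (at (x $ 2))"
  shows "riemann (static_metric f) x i j k l =
    sectional_curvature (f (x $ 2)) (f1 (x $ 2)) f2 (x $ 2) i j *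
      (static_metric f x $ i $ l * static_metric f x $ j $ k
       - static_metric f x $ i $ k * static_metric f x $ j $ l)"
proof -
  let ?K = "sectional_curvature (f (x $ 2)) (f1 (x $ 2)) f2 (x $ 2) i j"
  let ?g = "static_metric f x"
  have "riemann (static_metric f) x i j k l =
      (\<Sum>m\<in>UNIV. (if m = i then ?K * ?g $ j $ k * ?g $ m $ l else 0)
        - (if m = j then ?K * ?g $ i $ k * ?g $ m $ l else 0))"
    unfolding riemann_def riemann_up_static_metric[of x f f1 f2, OF assms]
    by (rule sum.cong) (simp_all add: left_diff_distrib right_diff_distrib del: diagonal_metric_nth)
  also have "\<dots> = ?K * (?g $ i $ l * ?g $ j $ k - ?g $ i $ k * ?g $ j $ l)"
    by (simp add: sum_subtractf algebra_simps del: diagonal_metric_nth)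
  finally show ?thesis .
qed

text \<open>
  In direction \<open>j\<close> the Ricci eigenvalue is the sum of the sectional curvatures of the three
  coordinate planes containing that direction. Two of these are always mixed, so there are just
  two eigenvalues, and they differ exactly as the curvatures of the two unmixed planes do.
\<close>

lemma ricci_static_metric:
  assumes "x $ 2 > 0" "f (x $ 2) \<noteq> 0" "sin (x $ 3) \<noteq> 0"
    and "\<forall>r>0. (f has_real_derivative f1 r) (at r)"
    and "(f1 has_real_derivative f2) (at (x $ 2))"
  shows "ricci (static_metric f) x $ j $ k =
    ((if j \<in> {1, 2} then - f2 / 2 else (1 - f (x $ 2)) / (x $ 2)\<^sup>2) - f1 (x $ 2) / x $ 2)
      * static_metric f x $ j $ k"
proof -
  let ?K = "sectional_curvature (f (x $ 2)) (f1 (x $ 2)) f2 (x $ 2)"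
  let ?g = "static_metric f x"
  have "ricci (static_metric f) x $ j $ k
      = (\<Sum>m\<in>UNIV. ?K m j * (?g $ j $ k - (if m = j then ?g $ j $ k else 0)))"
    unfolding ricci_def riemann_up_static_metric[of x f f1 f2, OF assms]
    by (simp del: diagonal_metric_nth cong: if_cong)
  also have "\<dots> = (\<Sum>m\<in>UNIV. if m = j then 0 else ?K m j) * ?g $ j $ k"
    unfolding sum_distrib_right by (rule sum.cong) simp_all
  also have "(\<Sum>m\<in>UNIV. if m = j then 0 else ?K m j)
      = (if j \<in> {1, 2} then - f2 / 2 else (1 - f (x $ 2)) / (x $ 2)\<^sup>2) - f1 (x $ 2) / x $ 2"
    using exhaust_4[of j] assms(1)
    by (auto simp: sum_4 sectional_curvature_def field_simps)
  finally show ?thesis .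
qed

text \<open>
  The symmetric functions $uv$, $u+v$ and $1$ on $\{a,b\}^2$ take arbitrary prescribed values at
  $(a,a)$, $(a,b)$, $(b,b)$ as soon as $a \neq b$: this is interpolation by a symmetric
  polynomial of degree at most one in each variable.
\<close>

lemma roter_coefficients_exist:
  fixes a b K1 K2 K3 :: real
  assumes "a \<noteq> b"
  shows "\<exists>N1 N2 N3. K1 = 2 * N1 * (a * a) + N2 * (a + a) + 2 * N3
    \<and> K2 = 2 * N1 * (a * b) + N2 * (a + b) + 2 * N3
    \<and> K3 = 2 * N1 * (b * b) + N2 * (b + b) + 2 * N3"
proof -
  define d where "d = a - b"
  define N1 where "N1 = (K1 - 2 * K2 + K3) / (2 * d\<^sup>2)"
  define N2 where "N2 = (K1 - K2) / d - 2 * N1 * a"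
  define N3 where "N3 = (K1 - 2 * N1 * (a * a) - N2 * (a + a)) / 2"
  have d: "d \<noteq> 0" and b: "b = a - d"
    using assms by (simp_all add: d_def)
  have 1: "2 * N1 * d * d = K1 - 2 * K2 + K3"
    using d by (simp add: N1_def power2_eq_square)
  have 2: "N2 * d + 2 * N1 * a * d = K1 - K2"
    using d by (simp add: N2_def field_simps)
  have 3: "K1 = 2 * N1 * (a * a) + N2 * (a + a) + 2 * N3"
    by (simp add: N3_def field_simps)
  have 4: "K2 = 2 * N1 * (a * b) + N2 * (a + b) + 2 * N3"
    using 2 3 by (simp add: b algebra_simps)
  have "K3 = 2 * N1 * (b * b) + N2 * (b + b) + 2 * N3"
    using 1 2 3 by (simp add: b algebra_simps)
  with 3 4 show ?thesis by blast
qed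

section \<open>The Roter condition\<close>

text \<open>
  For a diagonal metric with $\mathit{Ric}_{ij} = \rho_i g_{ij}$, each of the three
  Kulkarni--Nomizu products is a multiple of $g_{il}g_{jk} - g_{ik}g_{jl}$, the factors being
  $2\rho_i\rho_j$, $\rho_i+\rho_j$ and $2$. The Roter equation thus says that the sectional
  curvature of the plane $(i,j)$ is the corresponding symmetric function of $(\rho_i,\rho_j)$;
  there are three such values to match, and the inequality assumed on \<open>U\<close> is the distinctness
  of the two Ricci eigenvalues.
\<close>

theorem roter_type_static_metric:
  assumes U: "\<And>x. x \<in> U \<Longrightarrow> x $ 2 > 0 \<and> f (x $ 2) \<noteq> 0 \<and> sin (x $ 3) \<noteq> 0"
    and f: "\<forall>r>0. (f has_real_derivative f1 r) (at r)"
    and f1: "\<And>r. r > 0 \<Longrightarrow> (f1 has_real_derivative f2 r) (at r)"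
    and neq: "\<And>x. x \<in> U \<Longrightarrow> - f2 (x $ 2) / 2 \<noteq> (1 - f (x $ 2)) / (x $ 2)\<^sup>2"
  shows "roter_type_on U (static_metric f)"
proof -
  have "\<exists>N1 N2 N3. \<forall>i j k l. riemann (static_metric f) x i j k l =
          N1 * kulkarni_nomizu (ricci (static_metric f) x) (ricci (static_metric f) x) i j k l
          + N2 * kulkarni_nomizu (static_metric f x) (ricci (static_metric f) x) i j k l
          + N3 * kulkarni_nomizu (static_metric f x) (static_metric f x) i j k l"
    if "x \<in> U" for x
  proof -
    let ?r = "x $ 2" and ?g = "static_metric f x"
    note x = U[OF that, THEN conjunct1] U[OF that, THEN conjunct2, THEN conjunct1]
      U[OF that, THEN conjunct2, THEN conjunct2]
    note curv = x f f1[OF x(1)]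
    define a where "a = - f2 ?r / 2 - f1 ?r / ?r"
    define b where "b = (1 - f ?r) / ?r\<^sup>2 - f1 ?r / ?r"
    define \<rho> where "\<rho> = (\<lambda>i::4. if i \<in> {1, 2} then a else b)"
    have "a \<noteq> b"
      using neq[OF that] by (simp add: a_def b_def)
    then obtain N1 N2 N3 where
      N: "- f2 ?r / 2 = 2 * N1 * (a * a) + N2 * (a + a) + 2 * N3"
        "- f1 ?r / (2 * ?r) = 2 * N1 * (a * b) + N2 * (a + b) + 2 * N3"
        "(1 - f ?r) / ?r\<^sup>2 = 2 * N1 * (b * b) + N2 * (b + b) + 2 * N3"
      using roter_coefficients_exist by blast
    have K: "sectional_curvature (f ?r) (f1 ?r) (f2 ?r) ?r i j
        = 2 * N1 * (\<rho> i * \<rho> j) + N2 * (\<rho> i + \<rho> j) + 2 * N3" for i j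
      unfolding sectional_curvature_def \<rho>_def N
      using exhaust_4[of i] exhaust_4[of j]
      by (elim disjE) (simp_all add: algebra_simps)
    have ric: "ricci (static_metric f) x $ i $ j = \<rho> i * ?g $ i $ j" for i j
      unfolding ricci_static_metric[of x f f1 "f2 (x $ 2)", OF curv] \<rho>_def a_def b_def by simp
    have "riemann (static_metric f) x i j k l =
          N1 * kulkarni_nomizu (ricci (static_metric f) x) (ricci (static_metric f) x) i j k l
          + N2 * kulkarni_nomizu ?g (ricci (static_metric f) x) i j k l
          + N3 * kulkarni_nomizu ?g ?g i j k l" for i j k l
      unfolding riemann_static_metric[of x f f1 "f2 (x $ 2)", OF curv] K kulkarni_nomizu_def ric
      by (simp add: algebra_simps del: diagonal_metric_nth)
    then show ?thesis by blast
  qed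
  then show ?thesis
    unfolding roter_type_on_def by metis
qed

lemma rnds_metric_eq_static_metric: "rnds_metric M e \<Lambda> = static_metric (rnds_f M e \<Lambda>)"
proof -
  have "rnds_metric M e \<Lambda> x $ i $ j = static_metric (rnds_f M e \<Lambda>) x $ i $ j" for x i j
    using exhaust_4[of i] by (auto simp: rnds_metric_def static_coeff_def)
  then show ?thesis
    by (simp add: fun_eq_iff vec_eq_iff)
qed

theorem mainTheorem8:
  fixes M e \<Lambda> :: real
  assumes "M > 0" and "e \<noteq> 0" and "\<Lambda> > 0"
  shows "roter_type_on (rnds_domain M e \<Lambda>) (rnds_metric M e \<Lambda>)"
  unfolding rnds_metric_eq_static_metric
proof (rule roter_type_static_metric)
  fix x assume x: "x \<in> rnds_domain M e \<Lambda>"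
  then show "x $ 2 > 0 \<and> rnds_f M e \<Lambda> (x $ 2) \<noteq> 0 \<and> sin (x $ 3) \<noteq> 0"
    using sin_gt_zero[of "x $ 3"] by (auto simp: rnds_domain_def)
  \<comment> \<open>The mass and the cosmological constant cancel in the difference of the two curvatures.\<close>
  have "- (- 4 * M / (x $ 2) ^ 3 + 6 * e\<^sup>2 / (x $ 2) ^ 4 - 2 * \<Lambda>) / 2
      - (1 - rnds_f M e \<Lambda> (x $ 2)) / (x $ 2)\<^sup>2 = - 2 * e\<^sup>2 / (x $ 2) ^ 4"
    using x by (simp add: rnds_domain_def rnds_f_def field_simps eval_nat_numeral)
  moreover have "- 2 * e\<^sup>2 / (x $ 2) ^ 4 \<noteq> 0"
    using x \<open>e \<noteq> 0\<close> by (simp add: rnds_domain_def)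
  ultimately show "- (- 4 * M / (x $ 2) ^ 3 + 6 * e\<^sup>2 / (x $ 2) ^ 4 - 2 * \<Lambda>) / 2
      \<noteq> (1 - rnds_f M e \<Lambda> (x $ 2)) / (x $ 2)\<^sup>2"
    by linarith
next
  have "(rnds_f M e \<Lambda> has_real_derivative 2 * M / r\<^sup>2 - 2 * e\<^sup>2 / r ^ 3 - 2 * \<Lambda> * r) (at r)"
    if "r > 0" for r
    unfolding rnds_f_def using that
    by (auto intro!: derivative_eq_intros simp: field_simps eval_nat_numeral)
  then show "\<forall>r>0. (rnds_f M e \<Lambda>
      has_real_derivative 2 * M / r\<^sup>2 - 2 * e\<^sup>2 / r ^ 3 - 2 * \<Lambda> * r) (at r)"
    by blast
next
  fix r :: real assume r: "r > 0"
  show "((\<lambda>r. 2 * M / r\<^sup>2 - 2 * e\<^sup>2 / r ^ 3 - 2 * \<Lambda> * r)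
      has_real_derivative - 4 * M / r ^ 3 + 6 * e\<^sup>2 / r ^ 4 - 2 * \<Lambda>) (at r)"
    using r by (auto intro!: derivative_eq_intros simp: field_simps eval_nat_numeral)
qed

end
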